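(* Let $F(x,y)=\sum_{n\ge1}\sum_{\sigma\in S_n(T_1)}x^ny^{asc(\sigma)}$ and $E(x,y)=\sum_{n\ge1}\sum_{\sigma\in S_n(T_1),\,\sigma(n)=n}x^ny^{asc(\sigma)}$. Then $$F(x,y)=\frac{E(x,y)\bigl(1-yE(x,y)\bigr)}{1-E(x,y)-yE(x,y)}.$$
   Context: A permutation $\sigma$ avoids $\tau$ if no subsequence of $\sigma$ has the same relative order as $\tau$. $T_1=\{3214,3241,4213,4231\}$ and $S_n(T_1)$ is the set of permutations in $S_n$ avoiding all four patterns. $asc(\sigma)$ is the number of positions $i$ with $\sigma(i)<\sigma(i+1)$. Generating functions are formal power series. *)

theory Defs
  imports
    "HOL-Combinatorics.Multiset_Permutations"
    "HOL-Computational_Algebra.Formal_Power_Series"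
    "HOL-Library.Sublist"
begin

text \<open>
  Permutations of \<open>{1..n}\<close> are written in one-line notation, i.e. as the lists in
  \<^term>\<open>permutations_of_set {1..n}\<close>; the value \<open>\<sigma>(i)\<close> is the list entry \<open>\<sigma> ! (i - 1)\<close>.
\<close>

definition same_relative_order :: "nat list \<Rightarrow> nat list \<Rightarrow> bool" where
  "same_relative_order us \<tau> \<longleftrightarrow> length us = length \<tau> \<and>
     (\<forall>i < length \<tau>. \<forall>j < length \<tau>. us ! i < us ! j \<longleftrightarrow> \<tau> ! i < \<tau> ! j)"

definition avoids :: "nat list \<Rightarrow> nat list \<Rightarrow> bool" where
  "avoids \<sigma> \<tau> \<longleftrightarrow> \<not> (\<exists>us. subseq us \<sigma> \<and> same_relative_order us \<tau>)"

definition avoiders :: "nat \<Rightarrow> nat list set \<Rightarrow> nat list set" where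
  "avoiders n T = {\<sigma> \<in> permutations_of_set {1..n}. \<forall>\<tau> \<in> T. avoids \<sigma> \<tau>}"

definition T\<^sub>1 :: "nat list set" where
  "T\<^sub>1 = {[3,2,1,4], [3,2,4,1], [4,2,1,3], [4,2,3,1]}"

definition asc :: "nat list \<Rightarrow> nat" where
  "asc \<sigma> = card {i. Suc i < length \<sigma> \<and> \<sigma> ! i < \<sigma> ! Suc i}"

text \<open>
  Bivariate power series are elements of \<^typ>\<open>rat fps fps\<close>, read as series in \<open>x\<close> whose
  coefficients are series in \<open>y\<close>: the outer \<^const>\<open>fps_X\<close> is \<open>x\<close>, and \<open>y\<close> is as follows.
\<close>

definition fps_Y :: "rat fps fps" where
  "fps_Y = fps_const fps_X"

definition F_series :: "rat fps fps" where
  "F_series = Abs_fps (\<lambda>n. if n \<ge> 1 then \<Sum>\<sigma> \<in> avoiders n T\<^sub>1. fps_X ^ asc \<sigma> else 0)"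

definition E_series :: "rat fps fps" where
  "E_series = Abs_fps (\<lambda>n. if n \<ge> 1
     then \<Sum>\<sigma> \<in> {\<sigma> \<in> avoiders n T\<^sub>1. \<sigma> ! (n - 1) = n}. fps_X ^ asc \<sigma> else 0)"

text \<open>
  The coefficient ring \<^typ>\<open>rat fps\<close> is not a field, but division of bivariate series
  by a series with constant coefficient \<open>1\<close> in \<open>x\<close> is the genuine one, and the denominator
  \<open>1 - E - y E\<close> is of this kind.
\<close>

lemma fps_divide_mult_cancel:
  fixes A D :: "rat fps fps"
  assumes "fps_nth D 0 = 1"
  shows "A / D * D = A"
proof -
  have "D * inverse D = 1"
    unfolding fps_inverse_def[of D] by (rule fps_right_inverse) (simp add: assms)
  moreover have "A / D = A * inverse D"
    using assms by (simp add: fps_divide_def subdegree_eq_0 Let_def)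
  ultimately show ?thesis by (simp add: ac_simps)
qed

lemma fps_nth_0_denominator: "fps_nth (1 - E_series - fps_Y * E_series) 0 = 1"
  by (simp add: E_series_def)

end

theory Submission
  imports Defs
begin

text \<open>
  A permutation avoids \<open>T\<^sub>1\<close> iff every entry \<open>b\<close> that is not a left-to-right maximum is
  smaller than all later entries or larger than all later entries.  Read such a permutation from left
  to right and keep track of the number \<open>h\<close> of unused values below the current maximum.
  Until the maximum \<open>n\<close> appears, an entry is either a new maximum or the smallest unused
  value; once \<open>n\<close> has appeared, each entry is the least or the greatest remaining one, so
  \<open>h\<close> remaining values contribute \<open>b\<^sub>h = (1 + y) ^ (h - 1)\<close> (and \<open>b\<^sub>0 = 1\<close>).
  Prescribing \<open>\<sigma>(n) = n\<close> replaces \<open>b\<close> by the unit vector \<open>d\<close> at \<open>0\<close>.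
  Hence \<open>[x\<^sup>n] F = (L\<^bsup>n-1\<^esup> b)\<^sub>0\<close> and \<open>[x\<^sup>n] E = (L\<^bsup>n-1\<^esup> d)\<^sub>0\<close> for one linear
  operator \<open>L\<close> on sequences.  It commutes with the right shift \<open>S\<close> up to a multiple of \<open>d\<close>:
  \<open>L S v = S L v + v\<^sub>0 d\<close>, so replacing the initial vector \<open>v\<close> by \<open>S v\<close> multiplies the
  generating function by \<open>E\<close>.  Finally \<open>b = d - y S d + (1 + y) S b\<close> turns into
  \<open>F = E - y E\<^sup>2 + (1 + y) E F\<close>.
\<close>

section \<open>Pattern avoidance as a left-to-right scan\<close>

definition mixed :: "nat \<Rightarrow> nat set \<Rightarrow> bool" where
  "mixed b S \<longleftrightarrow> (\<exists>c\<in>S. c < b) \<and> (\<exists>d\<in>S. b < d)"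

text \<open>
  \<open>M\<close> is the maximum of the entries already read; \<open>C\<close> demands in addition that the last entry
  of the whole word be its maximum.
\<close>

fun scan :: "bool \<Rightarrow> nat \<Rightarrow> nat list \<Rightarrow> bool" where
  "scan C M [] \<longleftrightarrow> True"
| "scan C M (x # xs) \<longleftrightarrow>
     (if M < x then scan C x xs
      else \<not> mixed x (set xs) \<and> (C \<longrightarrow> (\<exists>d\<in>set xs. x < d)) \<and> scan C M xs)"

text \<open>Only the running maximum matters: an entry lies below some predecessor iff it lies below
  the largest one, so in each case of the induction one of \<open>M\<close> and \<open>x\<close> is
  redundant among the predecessors.\<close>

lemma scan_False_iff:
  "scan False M xs \<longleftrightarrow>
     (\<forall>qs b zs. xs = qs @ b # zs \<and> (\<exists>a\<in>set (M # qs). b < a) \<longrightarrow> \<not> mixed b (set zs))"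
  if "M \<notin> set xs" "distinct xs"
  using that
proof (induction xs arbitrary: M)
  case (Cons x xs)
  have split: "(\<forall>qs b zs. x # xs = qs @ b # zs \<and> (\<exists>a\<in>set (M # qs). b < a) \<longrightarrow> \<not> mixed b (set zs)) \<longleftrightarrow>
     (x < M \<longrightarrow> \<not> mixed x (set xs)) \<and>
     (\<forall>qs b zs. xs = qs @ b # zs \<and> (\<exists>a\<in>set (M # x # qs). b < a) \<longrightarrow> \<not> mixed b (set zs))"
    (is "?L \<longleftrightarrow> ?A \<and> ?B")
  proof (intro iffI conjI)
    assume L: ?L
    show ?A using L[rule_format, of "[]" x xs] by auto
    show ?B
    proof (intro allI impI)
      fix qs b zs assume "xs = qs @ b # zs \<and> (\<exists>a\<in>set (M # x # qs). b < a)"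
      then show "\<not> mixed b (set zs)" using L[rule_format, of "x # qs" b zs] by auto
    qed
  next
    assume AB: "?A \<and> ?B"
    show ?L
    proof (intro allI impI, elim conjE)
      fix qs b zs assume *: "x # xs = qs @ b # zs" "\<exists>a\<in>set (M # qs). b < a"
      show "\<not> mixed b (set zs)"
      proof (cases qs)
        case Nil
        then show ?thesis using * AB by auto
      next
        case (Cons q qs')
        then show ?thesis using * AB by auto
      qed
    qed
  qed
  show ?case
  proof (cases "M < x")
    case True
    then have "(\<exists>a\<in>set (M # x # qs). b < a) \<longleftrightarrow> (\<exists>a\<in>set (x # qs). b < a)" for qs and b :: nat
      by auto
    then show ?thesis unfolding split using True Cons by simp
  next
    case False
    then have "x < M" using Cons.prems by auto
    then have "(\<exists>a\<in>set (M # x # qs). b < a) \<longleftrightarrow> (\<exists>a\<in>set (M # qs). b < a)" for qs and b :: nat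
      by auto
    then show ?thesis unfolding split using \<open>x < M\<close> Cons by simp
  qed
qed simp

text \<open>If the last entry is maximal, it is the larger later value demanded of every earlier
  non-record; a last entry below the running maximum has no such value.\<close>

lemma scan_True_iff:
  "scan True M xs \<longleftrightarrow> scan False M xs \<and> (\<forall>z\<in>set (M # xs). z \<le> last (M # xs))"
  if "M \<notin> set xs" "distinct xs"
  using that
proof (induction xs arbitrary: M)
  case (Cons x xs)
  show ?case
  proof (cases "M < x")
    case True
    then show ?thesis using Cons by auto
  next
    case False
    then have "x < M" using Cons.prems by auto
    show ?thesis
    proof (cases "xs = []")
      case False
      have IH: "scan True M xs \<longleftrightarrow> scan False M xs \<and> (\<forall>z\<in>set (M # xs). z \<le> last (M # xs))"
        using Cons by auto
      have "last xs \<in> set xs" using False by simp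
      then show ?thesis using \<open>x < M\<close> False IH by (auto intro: bexI[of _ "last xs"])
    qed (use \<open>x < M\<close> in auto)
  qed
qed simp

lemma subseq_Cons_iff:
  "subseq (x # xs) ys \<longleftrightarrow> (\<exists>us vs. ys = us @ x # vs \<and> subseq xs vs)"
proof
  assume "subseq (x # xs) ys"
  from list_emb_ConsD[OF this] show "\<exists>us vs. ys = us @ x # vs \<and> subseq xs vs" by auto
qed (auto intro: list_emb_append2)

lemma same_relative_order_4:
  "same_relative_order us [p,q,r,s] \<longleftrightarrow> (\<exists>a b c d. us = [a,b,c,d] \<and>
     (\<forall>(u,v) \<in> set (zip [a,b,c,d] [p,q,r,s]). \<forall>(u',v') \<in> set (zip [a,b,c,d] [p,q,r,s]). u < u' \<longleftrightarrow> v < v'))"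
proof (cases "length us = 4")
  case True
  then obtain a b c d where "us = [a,b,c,d]"
    by (auto simp: numeral_eq_Suc length_Suc_conv)
  then show ?thesis
    by (simp add: same_relative_order_def All_less_Suc) (simp only: conj_ac)
next
  case False
  then have "us \<noteq> [a,b,c,d]" for a b c d by auto
  then show ?thesis using False by (simp add: same_relative_order_def)
qed

text \<open>The four patterns are the two orders of the final pair \<open>c\<close>,
  \<open>d\<close> combined with the two comparisons of \<open>a\<close> and \<open>d\<close>;
  distinctness excludes \<open>a = d\<close>.\<close>

lemma avoids_T1_iff_subseq:
  assumes "distinct \<sigma>"
  shows "(\<forall>\<tau>\<in>T\<^sub>1. avoids \<sigma> \<tau>) \<longleftrightarrow>
    (\<forall>a b c d. b < a \<and> c < b \<and> b < (d::nat) \<longrightarrow> \<not> subseq [a,b,c,d] \<sigma> \<and> \<not> subseq [a,b,d,c] \<sigma>)"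
    (is "?L \<longleftrightarrow> ?R")
proof
  assume R: ?R
  show ?L
    unfolding T\<^sub>1_def avoids_def using R by (auto simp: same_relative_order_4)
next
  assume L: ?L
  show ?R
  proof (intro allI impI)
    fix a b c d :: nat assume *: "b < a \<and> c < b \<and> b < d"
    have *: "\<not> (subseq [a,b,c,d] \<sigma> \<or> subseq [a,b,d,c] \<sigma>)" if "a \<noteq> d"
    proof (cases "a < d")
      case True
      then have "same_relative_order [a,b,c,d] [3,2,1,4]" "same_relative_order [a,b,d,c] [3,2,4,1]"
        using * by (simp_all add: same_relative_order_4)
      then show ?thesis using L unfolding T\<^sub>1_def avoids_def by blast
    next
      case False
      then have "same_relative_order [a,b,c,d] [4,2,1,3]" "same_relative_order [a,b,d,c] [4,2,3,1]"
        using * that by (simp_all add: same_relative_order_4)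
      then show ?thesis using L unfolding T\<^sub>1_def avoids_def by blast
    qed
    have "a \<noteq> d" if "subseq [a,b,c,d] \<sigma> \<or> subseq [a,b,d,c] \<sigma>"
      using that assms by (auto simp: subseq_Cons_iff)
    with * show "\<not> subseq [a,b,c,d] \<sigma> \<and> \<not> subseq [a,b,d,c] \<sigma>" by blast
  qed
qed

text \<open>As both orders of \<open>c\<close> and \<open>d\<close> are forbidden, only their
  membership in the suffix after \<open>b\<close> counts.\<close>

lemma avoids_T1_iff_split:
  assumes "distinct \<sigma>"
  shows "(\<forall>\<tau>\<in>T\<^sub>1. avoids \<sigma> \<tau>) \<longleftrightarrow>
    (\<forall>qs b zs. \<sigma> = qs @ b # zs \<and> (\<exists>a\<in>set qs. b < a) \<longrightarrow> \<not> mixed b (set zs))"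
    (is "_ \<longleftrightarrow> ?R")
proof -
  have two: "subseq [c,d] zs \<or> subseq [d,c] zs \<longleftrightarrow> c \<in> set zs \<and> d \<in> set zs" if "c \<noteq> d"
    for c d :: nat and zs
    using that by (induction zs) (auto simp: subseq_singleton_left)
  have four: "(subseq [a,b,c,d] \<sigma> \<or> subseq [a,b,d,c] \<sigma>) \<longleftrightarrow>
      (\<exists>qs zs. \<sigma> = qs @ b # zs \<and> a \<in> set qs \<and> c \<in> set zs \<and> d \<in> set zs)" (is "?A \<longleftrightarrow> ?B")
    if "c \<noteq> d" for a b c d
  proof
    assume ?A
    then obtain us vs zs where "\<sigma> = us @ a # vs @ b # zs" "subseq [c,d] zs \<or> subseq [d,c] zs"
      unfolding subseq_Cons_iff[of a] subseq_Cons_iff[of b] by blast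
    then have "\<sigma> = (us @ a # vs) @ b # zs \<and> a \<in> set (us @ a # vs) \<and> c \<in> set zs \<and> d \<in> set zs"
      using two[OF that] by simp
    then show ?B by blast
  next
    assume ?B
    then obtain qs zs where *: "\<sigma> = qs @ b # zs" "a \<in> set qs" "c \<in> set zs" "d \<in> set zs" by blast
    then obtain us vs where "qs = us @ a # vs" by (meson split_list)
    with * two[OF that] show ?A
      unfolding subseq_Cons_iff[of a] subseq_Cons_iff[of b] by (metis append.assoc append_Cons)
  qed
  have "?R \<longleftrightarrow> (\<forall>a b c d. b < a \<and> c < b \<and> b < d \<longrightarrow>
      \<not> (\<exists>qs zs. \<sigma> = qs @ b # zs \<and> a \<in> set qs \<and> c \<in> set zs \<and> d \<in> set zs))"
    unfolding mixed_def by blast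
  also have "\<dots> \<longleftrightarrow> (\<forall>\<tau>\<in>T\<^sub>1. avoids \<sigma> \<tau>)"
    unfolding avoids_T1_iff_subseq[OF assms]
  proof (intro iff_allI imp_cong refl)
    fix a b c d :: nat assume "b < a \<and> c < b \<and> b < d"
    then have "c \<noteq> d" by simp
    then show "\<not> (\<exists>qs zs. \<sigma> = qs @ b # zs \<and> a \<in> set qs \<and> c \<in> set zs \<and> d \<in> set zs) \<longleftrightarrow>
        \<not> subseq [a,b,c,d] \<sigma> \<and> \<not> subseq [a,b,d,c] \<sigma>"
      using four[of c d a b] by blast
  qed
  finally show ?thesis by blast
qed

lemma avoiders_T1: "avoiders n T\<^sub>1 = {\<sigma> \<in> permutations_of_set {1..n}. scan False 0 \<sigma>}"
proof -
  have "(\<forall>\<tau>\<in>T\<^sub>1. avoids \<sigma> \<tau>) \<longleftrightarrow> scan False 0 \<sigma>" if "\<sigma> \<in> permutations_of_set {1..n}" for \<sigma>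
  proof -
    have "distinct \<sigma>" "0 \<notin> set \<sigma>" using that by (auto simp: permutations_of_set_def)
    then show ?thesis by (simp add: scan_False_iff avoids_T1_iff_split)
  qed
  then show ?thesis by (auto simp: avoiders_def)
qed

lemma avoiders_T1_last:
  assumes "n \<ge> 1"
  shows "{\<sigma> \<in> avoiders n T\<^sub>1. \<sigma> ! (n - 1) = n} = {\<sigma> \<in> permutations_of_set {1..n}. scan True 0 \<sigma>}"
proof -
  have "scan False 0 \<sigma> \<and> \<sigma> ! (n - 1) = n \<longleftrightarrow> scan True 0 \<sigma>"
    if "\<sigma> \<in> permutations_of_set {1..n}" for \<sigma>
  proof -
    have \<sigma>: "distinct \<sigma>" "set \<sigma> = {1..n}" using that by (auto simp: permutations_of_set_def)
    have len: "length \<sigma> = n" using distinct_card[OF \<sigma>(1)] \<sigma>(2) by simp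
    then have "\<sigma> \<noteq> []" using assms by auto
    then have "last (0 # \<sigma>) = \<sigma> ! (n - 1)" "last (0 # \<sigma>) \<in> {1..n}"
      using len \<sigma> last_in_set by (auto simp: last_conv_nth)
    then have "\<sigma> ! (n - 1) = n \<longleftrightarrow> (\<forall>z\<in>set (0 # \<sigma>). z \<le> last (0 # \<sigma>))"
      using \<sigma> assms by (auto intro: antisym)
    then show ?thesis using \<sigma> by (subst scan_True_iff) auto
  qed
  then show ?thesis by (auto simp: avoiders_T1)
qed

section \<open>Ascent-weighted sums over scanned words\<close>

lemma asc_single [simp]: "asc [x] = 0"
  by (simp add: asc_def)

lemma asc_Cons_Cons: "asc (p # x # xs) = of_bool (p < x) + asc (x # xs)"
proof -
  let ?A = "{i. Suc i < length (x # xs) \<and> (x # xs) ! i < (x # xs) ! Suc i}"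
  have "{i. Suc i < length (p # x # xs) \<and> (p # x # xs) ! i < (p # x # xs) ! Suc i} =
      (if p < x then {0} else {}) \<union> Suc ` ?A" (is "?B = ?C")
  proof (rule set_eqI)
    fix i show "i \<in> ?B \<longleftrightarrow> i \<in> ?C" by (cases i) auto
  qed
  moreover have "finite ?A" by (rule finite_subset[of _ "{..length xs}"]) auto
  ultimately show ?thesis
    unfolding asc_def by (subst card_Un_disjoint | simp add: card_image)+
qed

text \<open>\<open>p\<close> is the entry written just before the word, kept so that an ascent into
  the word is counted; it may be smaller than the running maximum \<open>M\<close>.\<close>

definition scan_sum :: "'a::comm_ring_1 \<Rightarrow> bool \<Rightarrow> nat \<Rightarrow> nat \<Rightarrow> nat set \<Rightarrow> 'a" where
  "scan_sum y C M p S = (\<Sum>xs\<in>{xs\<in>permutations_of_set S. scan C M xs}. y ^ asc (p # xs))"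

lemma scan_sum_empty [simp]: "scan_sum y C M p {} = 1"
proof -
  have "{xs \<in> permutations_of_set {}. scan C M xs} = {[]}" by auto
  then show ?thesis unfolding scan_sum_def by simp
qed

lemma scan_sum_rec:
  assumes "finite S" "S \<noteq> {}"
  shows "scan_sum y C M p S = (\<Sum>x\<in>S. y ^ of_bool (p < x) *
    (if M < x then scan_sum y C x x (S - {x})
     else if \<not> mixed x (S - {x}) \<and> (C \<longrightarrow> (\<exists>d\<in>S - {x}. x < d)) then scan_sum y C M x (S - {x}) else 0))"
proof -
  let ?T = "\<lambda>x. {xs \<in> permutations_of_set (S - {x}). scan C M (x # xs)}"
  have "{xs\<in>permutations_of_set S. scan C M xs} = (\<Union>x\<in>S. (#) x ` ?T x)"
    unfolding permutations_of_set_nonempty[OF assms(2)] by auto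
  then have "scan_sum y C M p S = (\<Sum>x\<in>S. \<Sum>xs\<in>(#) x ` ?T x. y ^ asc (p # xs))"
    unfolding scan_sum_def using assms(1)
    by (simp only:) (rule sum.UNION_disjoint; auto)
  also have "\<dots> = (\<Sum>x\<in>S. y ^ of_bool (p < x) * (\<Sum>xs\<in>?T x. y ^ asc (x # xs)))"
    by (intro sum.cong refl, subst sum.reindex)
       (auto simp: asc_Cons_Cons power_add sum_distrib_left)
  also have "\<dots> = (\<Sum>x\<in>S. y ^ of_bool (p < x) *
    (if M < x then scan_sum y C x x (S - {x})
     else if \<not> mixed x (S - {x}) \<and> (C \<longrightarrow> (\<exists>d\<in>S - {x}. x < d)) then scan_sum y C M x (S - {x}) else 0))"
  proof (intro sum.cong refl arg_cong2[where f = "(*)"])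
    fix x
    let ?cond = "\<not> mixed x (S - {x}) \<and> (C \<longrightarrow> (\<exists>d\<in>S - {x}. x < d))"
    have "?T x = (if M < x then {xs \<in> permutations_of_set (S - {x}). scan C x xs}
       else if ?cond then {xs \<in> permutations_of_set (S - {x}). scan C M xs} else {})"
    proof -
      have "scan C M (x # xs) = (if M < x then scan C x xs else ?cond \<and> scan C M xs)"
        if "xs \<in> permutations_of_set (S - {x})" for xs
        using permutations_of_setD(1)[OF that] by (simp add: conj_assoc)
      then show ?thesis by (auto cong: conj_cong)
    qed
    then show "(\<Sum>xs\<in>?T x. y ^ asc (x # xs)) =
      (if M < x then scan_sum y C x x (S - {x}) else if ?cond then scan_sum y C M x (S - {x}) else 0)"
      by (simp add: scan_sum_def)
  qed
  finally show ?thesis .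
qed

section \<open>The linear operator, its shift relation and its series\<close>

definition end_weight :: "'a::comm_ring_1 \<Rightarrow> bool \<Rightarrow> nat \<Rightarrow> 'a" where
  "end_weight y C h = (if h = 0 then 1 else if C then 0 else (1 + y) ^ (h - 1))"

text \<open>
  \<open>step\<close> processes the values above the current maximum one at a time: the next value is either
  skipped, which makes it a hole (\<open>v (Suc h)\<close>), or becomes the next maximum after the \<open>h - i\<close>
  smallest holes have been written, which creates \<open>max 1 (h - i)\<close> ascents.
\<close>

definition step :: "'a::comm_ring_1 \<Rightarrow> (nat \<Rightarrow> 'a) \<Rightarrow> nat \<Rightarrow> 'a" where
  "step y v h = (\<Sum>i\<le>h. y ^ max 1 (h - i) * v i) + v (Suc h)"

definition shift :: "(nat \<Rightarrow> 'a::comm_ring_1) \<Rightarrow> nat \<Rightarrow> 'a" where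
  "shift v h = (case h of 0 \<Rightarrow> 0 | Suc k \<Rightarrow> v k)"

text \<open>The weight depends only on \<open>h - i\<close>, so the shift passes through the sum; at
  \<open>h = 0\<close> only the skip term survives, which gives \<open>v 0\<close>.\<close>

lemma step_shift: "step y (shift v) h = shift (step y v) h + v 0 * of_bool (h = 0)"
proof (cases h)
  case (Suc k)
  have "step y (shift v) h = (\<Sum>i\<le>k. y ^ max 1 (k - i) * v i) + v (Suc k)"
    unfolding step_def Suc sum.atMost_Suc_shift by (simp add: shift_def)
  then show ?thesis by (simp add: Suc shift_def step_def)
qed (simp add: step_def shift_def)

lemma step_add: "step y (\<lambda>h. u h + v h) h = step y u h + step y v h"
  by (simp add: step_def algebra_simps sum.distrib)

lemma step_scale: "step y (\<lambda>h. c * v h) h = c * step y v h"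
  by (simp add: step_def algebra_simps sum_distrib_left)

lemma iter_step_linear:
  "(step y ^^ n) (\<lambda>h. u h + c * v h + d * w h) h =
    (step y ^^ n) u h + c * (step y ^^ n) v h + d * (step y ^^ n) w h"
proof (induction n arbitrary: h)
  case (Suc n)
  have "(step y ^^ n) (\<lambda>h. u h + c * v h + d * w h) =
     (\<lambda>h. (step y ^^ n) u h + c * (step y ^^ n) v h + d * (step y ^^ n) w h)"
    using Suc by auto
  then show ?case by (simp add: step_add step_scale)
qed simp

lemma step_sum:
  assumes "finite K"
  shows "step y (\<lambda>h. \<Sum>k\<in>K. c k * v k h) h = (\<Sum>k\<in>K. c k * step y (v k) h)"
  using assms
proof (induction K)
  case empty
  then show ?case by (simp add: step_def)
qed (simp add: step_add step_scale)

text \<open>By \<open>step_shift\<close>, the application after \<open>k\<close> steps leaks the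
  multiple \<open>(step y ^^ k) v 0\<close> of the unit vector, which the remaining
  \<open>n - 1 - k\<close> applications carry on.\<close>

lemma iter_step_shift:
  "(step y ^^ n) (shift v) h = shift ((step y ^^ n) v) h +
     (\<Sum>k<n. (step y ^^ k) v 0 * (step y ^^ (n - 1 - k)) (\<lambda>h. of_bool (h = 0)) h)"
proof (induction n arbitrary: h)
  case (Suc n)
  let ?d = "\<lambda>h. of_bool (h = 0)"
  have "(step y ^^ Suc n) (shift v) h = step y (\<lambda>h. shift ((step y ^^ n) v) h +
     (\<Sum>k<n. (step y ^^ k) v 0 * (step y ^^ (n - 1 - k)) ?d h)) h"
    using Suc[abs_def] by simp
  also have "\<dots> = shift ((step y ^^ Suc n) v) h + (step y ^^ n) v 0 * ?d h +
     (\<Sum>k<n. (step y ^^ k) v 0 * step y ((step y ^^ (n - 1 - k)) ?d) h)"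
    by (simp add: step_add step_shift step_sum)
  also have "(\<Sum>k<n. (step y ^^ k) v 0 * step y ((step y ^^ (n - 1 - k)) ?d) h) =
     (\<Sum>k<n. (step y ^^ k) v 0 * (step y ^^ (n - k)) ?d h)"
  proof (intro sum.cong refl)
    fix k assume "k \<in> {..<n}"
    then have "n - k = Suc (n - 1 - k)" by auto
    then show "(step y ^^ k) v 0 * step y ((step y ^^ (n - 1 - k)) ?d) h =
      (step y ^^ k) v 0 * (step y ^^ (n - k)) ?d h" by simp
  qed
  finally show ?case by (simp add: add_ac)
qed simp

text \<open>At \<open>h = 1\<close> the correction \<open>- y\<close> cancels the surplus of
  \<open>1 + y\<close>; from \<open>h = 2\<close> on the weights are geometric with ratio
  \<open>1 + y\<close>.\<close>

lemma end_weight_eq: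
  "end_weight y False h = end_weight y True h + (- y) * shift (end_weight y True) h
     + (1 + y) * shift (end_weight y False) h"
proof (cases h)
  case (Suc k)
  then show ?thesis by (cases k) (auto simp: end_weight_def shift_def)
qed (simp add: end_weight_def shift_def)

definition iter_series :: "'a::comm_ring_1 \<Rightarrow> (nat \<Rightarrow> 'a) \<Rightarrow> 'a fps" where
  "iter_series y v = Abs_fps (\<lambda>n. if n \<ge> 1 then (step y ^^ (n - 1)) v 0 else 0)"

text \<open>At \<open>h = 0\<close> the shifted term of \<open>iter_step_shift\<close> vanishes, and
  the sum that is left is a Cauchy product.\<close>

lemma iter_series_shift:
  "iter_series y (shift v) = iter_series y v * iter_series y (end_weight y True)"
proof (rule fps_ext)
  fix n
  have d: "end_weight y True = (\<lambda>h. of_bool (h = 0))" by (auto simp: end_weight_def)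
  show "fps_nth (iter_series y (shift v)) n = fps_nth (iter_series y v * iter_series y (end_weight y True)) n"
  proof (cases n)
    case (Suc m)
    have "fps_nth (iter_series y v * iter_series y (end_weight y True)) n =
      (\<Sum>k\<le>m. (step y ^^ k) v 0 * fps_nth (iter_series y (end_weight y True)) (m - k))"
      unfolding fps_mult_nth Suc atLeast0AtMost sum.atMost_Suc_shift by (simp add: iter_series_def)
    \<comment> \<open>The term \<open>k = m\<close> drops out because the second series has constant
      coefficient 0.\<close>
    also have "\<dots> = (\<Sum>k<m. (step y ^^ k) v 0 * fps_nth (iter_series y (end_weight y True)) (m - k))"
      by (rule sum.mono_neutral_right) (auto simp: iter_series_def)
    also have "\<dots> = (\<Sum>k<m. (step y ^^ k) v 0 * (step y ^^ (m - 1 - k)) (end_weight y True) 0)"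
      by (intro sum.cong) (auto simp: iter_series_def)
    finally show ?thesis by (simp add: Suc iter_series_def iter_step_shift d shift_def)
  qed (simp add: iter_series_def)
qed

lemma iter_series_equation:
  fixes y :: "'a::comm_ring_1"
  defines "F \<equiv> iter_series y (end_weight y False)" and "E \<equiv> iter_series y (end_weight y True)"
  shows "F = E + fps_const (- y) * (E * E) + fps_const (1 + y) * (F * E)"
proof -
  have "end_weight y False = (\<lambda>h. end_weight y True h + (- y) * shift (end_weight y True) h
     + (1 + y) * shift (end_weight y False) h)"
    using end_weight_eq by blast
  then have "F = iter_series y (\<lambda>h. end_weight y True h + (- y) * shift (end_weight y True) h
     + (1 + y) * shift (end_weight y False) h)"
    unfolding F_def by simp
  also have "\<dots> = E + fps_const (- y) * iter_series y (shift (end_weight y True))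
     + fps_const (1 + y) * iter_series y (shift (end_weight y False))"
    unfolding E_def iter_series_def iter_step_linear
    by (rule fps_ext) (simp del: fps_const_neg fps_const_add)
  finally show ?thesis by (simp add: iter_series_shift E_def F_def)
qed

section \<open>Evaluating the word sums by iterates of the operator\<close>

text \<open>
  The total weight of all completions of a word that has just reached a new maximum, with \<open>h\<close>
  unused values below and \<open>u\<close> unused values above it.
\<close>

definition max_run :: "'a::comm_ring_1 \<Rightarrow> bool \<Rightarrow> nat \<Rightarrow> nat \<Rightarrow> 'a" where
  "max_run y C h u = (case u of 0 \<Rightarrow> end_weight y C h
     | Suc m \<Rightarrow> (\<Sum>i\<le>h. y ^ max 1 (h - i) * (step y ^^ m) (end_weight y C) i))"

text \<open>\<open>j\<close> counts the values skipped before the next maximum; they turn into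
  holes. The term \<open>j = 0\<close> gives the sum in \<open>step\<close>, the others its summand
  at \<open>Suc h\<close>.\<close>

lemma sum_max_run: "(\<Sum>j\<le>u. max_run y C (h + j) (u - j)) = (step y ^^ u) (end_weight y C) h"
proof (induction u arbitrary: h)
  case (Suc u)
  have "(\<Sum>j\<le>Suc u. max_run y C (h + j) (Suc u - j)) =
      max_run y C h (Suc u) + (\<Sum>j\<le>u. max_run y C (Suc h + j) (u - j))"
    unfolding sum.atMost_Suc_shift by simp
  also have "\<dots> = max_run y C h (Suc u) + (step y ^^ u) (end_weight y C) (Suc h)"
    unfolding Suc ..
  finally show ?case by (simp add: max_run_def step_def[of y "(step y ^^ u) _"])
qed (simp add: max_run_def)

text \<open>The number of smaller elements is strictly increasing on \<open>A\<close>, hence a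
  bijection onto \<open>{..<card A}\<close>.\<close>

lemma sum_by_rank:
  fixes A :: "nat set"
  assumes "finite A"
  shows "(\<Sum>x\<in>A. \<phi> (card {z\<in>A. z < x}) (card {z\<in>A. x < z})) = (\<Sum>j<card A. \<phi> j (card A - 1 - j))"
proof -
  let ?r = "\<lambda>x. card {z\<in>A. z < x}"
  have less: "?r x < ?r x'" if "x \<in> A" "x < x'" for x x'
    using that assms by (intro psubset_card_mono) auto
  have inj: "inj_on ?r A"
  proof (rule inj_onI, rule ccontr)
    fix x x' assume *: "x \<in> A" "x' \<in> A" "?r x = ?r x'" "x \<noteq> x'"
    then consider "x < x'" | "x' < x" by linarith
    then show False using less[OF *(1), of x'] less[OF *(2), of x] *(3) by cases simp_all
  qed
  have "?r ` A \<subseteq> {..<card A}"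
    using assms by (auto intro!: psubset_card_mono)
  then have img: "?r ` A = {..<card A}"
    by (intro card_subset_eq) (auto simp: card_image[OF inj])
  have "card {z\<in>A. x < z} = card A - 1 - ?r x" if "x \<in> A" for x
  proof -
    have "A = insert x ({z\<in>A. z < x} \<union> {z\<in>A. x < z})" using that by auto
    then have "card A = Suc (card ({z\<in>A. z < x} \<union> {z\<in>A. x < z}))"
      using assms by (metis (no_types, lifting) card_insert_disjoint finite_Un finite_insert
          UnE less_irrefl mem_Collect_eq)
    also have "card ({z\<in>A. z < x} \<union> {z\<in>A. x < z}) = ?r x + card {z\<in>A. x < z}"
      using assms by (intro card_Un_disjoint) auto
    finally show ?thesis by simp
  qed
  then have "(\<Sum>x\<in>A. \<phi> (?r x) (card {z\<in>A. x < z})) = (\<Sum>x\<in>A. \<phi> (?r x) (card A - 1 - ?r x))"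
    by simp
  also have "\<dots> = (\<Sum>j\<in>?r ` A. \<phi> j (card A - 1 - j))"
    by (simp add: sum.reindex[OF inj])
  finally show ?thesis unfolding img .
qed

text \<open>Only the least and the greatest value of \<open>S\<close> are not mixed. The least is
  followed by an ascent, the greatest by a descent: a factor \<open>1 + y\<close> per entry except
  the last. Under \<open>C\<close> the greatest is forbidden, so no word is left.\<close>

lemma scan_sum_below:
  assumes "finite S" "\<forall>x\<in>S. x < M" "S \<noteq> {}" "(\<forall>x\<in>S. x < p) \<or> (\<forall>x\<in>S. p < x)"
  shows "scan_sum y C M p S = y ^ of_bool (\<forall>x\<in>S. p < x) * end_weight y C (card S)"
  using assms
proof (induction "card S" arbitrary: S p)
  case (Suc n)
  define a b where "a = Min S" and "b = Max S"
  have ab: "a \<in> S" "b \<in> S" "\<And>x. x \<in> S \<Longrightarrow> a \<le> x \<and> x \<le> b"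
    using Suc.prems by (auto simp: a_def b_def)
  let ?q = "y ^ of_bool (\<forall>x\<in>S. p < x)"
  let ?t = "\<lambda>x. if \<not> mixed x (S - {x}) \<and> (C \<longrightarrow> (\<exists>d\<in>S - {x}. x < d)) then scan_sum y C M x (S - {x}) else 0"
  have px: "p < x \<longleftrightarrow> (\<forall>x\<in>S. p < x)" if "x \<in> S" for x
    using that Suc.prems(4) by (meson less_asym)
  have "scan_sum y C M p S = (\<Sum>x\<in>S. ?q * ?t x)"
    unfolding scan_sum_rec[OF Suc.prems(1,3)]
  proof (intro sum.cong refl)
    fix x assume x: "x \<in> S"
    then have M: "\<not> M < x" using Suc.prems(2) by (meson less_asym)
    show "y ^ of_bool (p < x) * (if M < x then scan_sum y C x x (S - {x}) else ?t x) = ?q * ?t x"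
      unfolding px[OF x] if_not_P[OF M] ..
  qed
  also have "\<dots> = (\<Sum>x\<in>{a, b}. ?q * ?t x)"
  proof (rule sum.mono_neutral_right)
    have "mixed x (S - {x})" if "x \<in> S - {a, b}" for x
    proof -
      have "a < x" "x < b" using that ab(3)[of x] by auto
      then show ?thesis unfolding mixed_def using that ab by blast
    qed
    then show "\<forall>x\<in>S - {a, b}. ?q * ?t x = 0" by simp
  qed (use ab Suc.prems(1) in auto)
  also have "\<dots> = ?q * (\<Sum>x\<in>{a, b}. ?t x)" by (simp add: sum_distrib_left)
  also have "(\<Sum>x\<in>{a, b}. ?t x) = end_weight y C (card S)"
  proof (cases "a = b")
    case True
    then have "S = {a}" using ab by (force intro: antisym)
    then show ?thesis using True by (auto simp: end_weight_def mixed_def)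
  next
    case False
    then have "a < b" using ab by (simp add: order_less_le)
    have n: "card (S - {x}) = n" if "x \<in> S" for x using that Suc by simp
    have "b \<in> S - {a}" using \<open>a < b\<close> ab by simp
    then have "n \<noteq> 0" using n[OF ab(1)] Suc.prems(1) by (metis card_0_eq empty_iff finite_Diff)
    have lt: "\<forall>x\<in>S - {a}. a < x" "\<forall>x\<in>S - {b}. x < b"
      using ab by (auto simp: order_less_le)
    have nlt: "\<not> (\<forall>x\<in>S - {b}. b < x)" using ab(1) \<open>a < b\<close> by (auto intro: bexI[of _ a])
    have A: "scan_sum y C M a (S - {a}) = y ^ of_bool (\<forall>x\<in>S-{a}. a < x) * end_weight y C (card (S - {a}))"
      using Suc.prems lt n ab \<open>a < b\<close> by (intro Suc.hyps(1)) auto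
    have B: "scan_sum y C M b (S - {b}) = y ^ of_bool (\<forall>x\<in>S-{b}. b < x) * end_weight y C (card (S - {b}))"
      using Suc.prems lt n ab \<open>a < b\<close> by (intro Suc.hyps(1)) auto
    have ta: "?t a = y * end_weight y C n"
    proof -
      have "\<not> mixed a (S - {a})" "\<exists>d\<in>S - {a}. a < d"
        using lt(1) \<open>b \<in> S - {a}\<close> by (auto simp: mixed_def dest: less_asym)
      then show ?thesis using A lt(1) n[OF ab(1)] by simp
    qed
    have tb: "?t b = (if C then 0 else end_weight y C n)"
    proof -
      have "\<not> mixed b (S - {b})" "\<not> (\<exists>d\<in>S - {b}. b < d)"
        using lt(2) unfolding mixed_def by (meson less_asym)+
      moreover have "of_bool (\<forall>x\<in>S-{b}. b < x) = (0::nat)" using nlt by simp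
      ultimately show ?thesis using B n[OF ab(2)] by (simp only:) simp
    qed
    \<comment> \<open>This needs \<open>n \<noteq> 0\<close>: a single remaining value is both least
      and greatest and offers no choice.\<close>
    have "end_weight y C (Suc n) = y * end_weight y C n + (if C then 0 else end_weight y C n)"
      using \<open>n \<noteq> 0\<close> by (cases n) (auto simp: end_weight_def algebra_simps)
    then show ?thesis using ta tb False Suc.hyps(2) by simp
  qed
  finally show ?case .
qed simp

text \<open>While values above \<open>M\<close> remain, holes are written in increasing order. After
  \<open>p = M\<close> the first of them is a descent, so \<open>h - i\<close> holes and the next
  maximum give \<open>max 1 (h - i)\<close> ascents; after a hole \<open>p\<close> they give
  \<open>Suc (h - i)\<close>. The recursion mixes both situations, hence the joint
  induction.\<close>

lemma scan_sum_eq: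
  assumes "finite S" "M \<notin> S"
  defines "h \<equiv> card {z\<in>S. z < M}" and "u \<equiv> card {z\<in>S. M < z}"
  shows "scan_sum y C M M S = max_run y C h u"
    and "p < M \<Longrightarrow> \<forall>x\<in>S. p < x \<Longrightarrow> u = Suc m \<Longrightarrow>
      scan_sum y C M p S = (\<Sum>i\<le>h. y ^ Suc (h - i) * (step y ^^ m) (end_weight y C) i)"
  using assms(1,2) unfolding h_def u_def
proof (induction "card S" arbitrary: S M p m)
  case 0
  case 1
  with 0 show ?case by (simp add: max_run_def end_weight_def)
next
  case 0
  case 2
  with 0 show ?case by simp
next
  case (Suc n)
  let ?v = "\<lambda>m. (step y ^^ m) (end_weight y C)"
  \<comment> \<open>One recursion for both claims: the first summand takes a new maximum next, the
    second the least hole, which is an ascent exactly if \<open>p < M\<close>.\<close>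
  have main: "scan_sum y C M p S =
      y * ?v m (card {z\<in>S. z < M}) + y ^ of_bool (p < M) * (case card {z\<in>S. z < M} of 0 \<Rightarrow> 0
        | Suc k \<Rightarrow> (\<Sum>i\<le>k. y ^ Suc (k - i) * ?v m i))"
    if fin: "finite S" and M: "M \<notin> S" and n: "Suc n = card S"
      and u: "card {z\<in>S. M < z} = Suc m" and p: "p = M \<or> p < M \<and> (\<forall>x\<in>S. p < x)" for M p m S
  proof -
    let ?L = "{z\<in>S. z < M}" and ?H = "{z\<in>S. M < z}"
    let ?t = "\<lambda>x. y ^ of_bool (p < x) *
      (if M < x then scan_sum y C x x (S - {x})
       else if \<not> mixed x (S - {x}) \<and> (C \<longrightarrow> (\<exists>d\<in>S - {x}. x < d)) then scan_sum y C M x (S - {x}) else 0)"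
    have n': "n = card (S - {x})" if "x \<in> S" for x using that fin n by simp
    have "S \<noteq> {}" using n by auto
    have S: "?H \<union> ?L = S" using M by (auto, metis linorder_neqE_nat)
    have "scan_sum y C M p S = sum ?t (?H \<union> ?L)"
      unfolding scan_sum_rec[OF fin \<open>S \<noteq> {}\<close>] using S by simp
    also have "\<dots> = sum ?t ?H + sum ?t ?L"
      using fin by (intro sum.union_disjoint) auto
    \<comment> \<open>When \<open>x\<close> becomes the maximum, the skipped values of
      \<open>?H\<close> below \<open>x\<close> join the holes \<open>?L\<close>.\<close>
    also have "sum ?t ?H = (\<Sum>x\<in>?H. y * max_run y C (card ?L + card {z\<in>?H. z < x}) (card {z\<in>?H. x < z}))"
    proof (intro sum.cong refl)
      fix x assume x: "x \<in> ?H"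
      have "{z\<in>S - {x}. z < x} = ?L \<union> {z\<in>?H. z < x}"
      proof (rule set_eqI)
        fix z
        show "z \<in> {z\<in>S - {x}. z < x} \<longleftrightarrow> z \<in> ?L \<union> {z\<in>?H. z < x}"
          using x M by (cases z M rule: linorder_cases) auto
      qed
      moreover have "card \<dots> = card ?L + card {z\<in>?H. z < x}"
        using fin by (intro card_Un_disjoint) auto
      moreover have "{z\<in>S - {x}. x < z} = {z\<in>?H. x < z}" using x by auto
      ultimately have "scan_sum y C x x (S - {x}) = max_run y C (card ?L + card {z\<in>?H. z < x}) (card {z\<in>?H. x < z})"
        using Suc.hyps(1)[of "S - {x}" x] n'[of x] x fin by simp
      then show "?t x = y * max_run y C (card ?L + card {z\<in>?H. z < x}) (card {z\<in>?H. x < z})"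
        using x p by auto
    qed
    also have "\<dots> = y * (\<Sum>x\<in>?H. max_run y C (card ?L + card {z\<in>?H. z < x}) (card {z\<in>?H. x < z}))"
      by (simp add: sum_distrib_left)
    also have "(\<Sum>x\<in>?H. max_run y C (card ?L + card {z\<in>?H. z < x}) (card {z\<in>?H. x < z})) =
      (\<Sum>j<card ?H. max_run y C (card ?L + j) (card ?H - 1 - j))"
      using fin by (subst sum_by_rank[where \<phi> = "\<lambda>j k. max_run y C (card ?L + j) k"]) auto
    also have "\<dots> = ?v m (card ?L)"
      unfolding u lessThan_Suc_atMost sum_max_run[symmetric] by simp
    also have "sum ?t ?L = y ^ of_bool (p < M) * (case card {z\<in>S. z < M} of 0 \<Rightarrow> 0
        | Suc k \<Rightarrow> (\<Sum>i\<le>k. y ^ Suc (k - i) * ?v m i))"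
    proof (cases "?L = {}")
      case False
      define a where "a = Min ?L"
      have "finite ?L" using fin by simp
      then have "a \<in> ?L" and "\<And>x. x \<in> ?L \<Longrightarrow> a \<le> x"
        unfolding a_def by (rule Min_in[OF _ False], rule Min_le)
      then have a: "a \<in> S" "a < M" "\<And>x. x \<in> S \<Longrightarrow> a \<le> x"
        by auto (metis (mono_tags, lifting) leI less_le_trans less_imp_le mem_Collect_eq)
      \<comment> \<open>The larger value \<open>d\<close> makes every hole except the least one,
        \<open>a\<close>, mixed.\<close>
      obtain d where d: "d \<in> S" "M < d" using u by (metis (no_types, lifting) card.empty
          empty_Collect_eq nat.distinct(1))
      have "sum ?t ?L = sum ?t {a}"
      proof (rule sum.mono_neutral_right)
        have "mixed x (S - {x})" if "x \<in> ?L - {a}" for x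
        proof -
          have "a < x" "x < d" using that a(3)[of x] d by auto
          then show ?thesis unfolding mixed_def using that a d by blast
        qed
        then show "\<forall>x\<in>?L - {a}. ?t x = 0" by auto
      qed (use a fin in auto)
      also have "\<dots> = y ^ of_bool (p < M) * scan_sum y C M a (S - {a})"
      proof -
        have "\<not> mixed a (S - {a})" using a(3) by (auto simp: mixed_def not_less)
        moreover have "\<exists>d\<in>S - {a}. a < d" using a(2) d by (intro bexI[of _ d]) auto
        moreover have "p < a \<longleftrightarrow> p < M" using p a(1,2) by auto
        ultimately show ?thesis using a(2) by simp
      qed
      finally have "sum ?t ?L = y ^ of_bool (p < M) * scan_sum y C M a (S - {a})" .
      moreover have "card ?L = Suc (card {z\<in>S - {a}. z < M})"
      proof -
        have "?L = insert a {z\<in>S - {a}. z < M}" using a by auto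
        then show ?thesis using fin by (metis (no_types, lifting) Diff_iff card_insert_disjoint
              finite_Diff finite_subset insertI1 mem_Collect_eq subsetI)
      qed
      moreover have "{z\<in>S - {a}. M < z} = ?H" using a by auto
      \<comment> \<open>\<open>a\<close> lies below all that remains, so the second claim applies
        with \<open>a\<close> as the preceding entry.\<close>
      then have "scan_sum y C M a (S - {a}) = (\<Sum>i\<le>card {z\<in>S - {a}. z < M}.
          y ^ Suc (card {z\<in>S - {a}. z < M} - i) * ?v m i)"
        using a fin M u n' by (intro Suc.hyps(2)) (auto simp: order_less_le)
      ultimately show ?thesis by simp
    next
      case True
      then show ?thesis unfolding True by simp
    qed
    finally show ?thesis .
  qed
  {
    case 1
    show ?case
    proof (cases "card {z\<in>S. M < z}")
      \<comment> \<open>Nothing exceeds \<open>M\<close>, so \<open>scan_sum_below\<close> covers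
        the rest, entered by a descent.\<close>
      case 0
      then have "{z\<in>S. M < z} = {}" using 1 by simp
      then have lt: "\<forall>x\<in>S. x < M" using 1(2) by (auto, metis linorder_neqE_nat)
      have "S \<noteq> {}" using Suc by auto
      have L: "{z\<in>S. z < M} = S" using lt by auto
      have "(\<forall>x\<in>S. M < x) = False" using lt \<open>S \<noteq> {}\<close> by (auto dest: less_asym)
      with scan_sum_below[OF 1(1) lt \<open>S \<noteq> {}\<close> disjI1[OF lt], of y C]
      have "scan_sum y C M M S = end_weight y C (card S)" by (simp only:) simp
      then show ?thesis unfolding 0 L by (simp add: max_run_def)
    next
      case (Suc m)
      \<comment> \<open>The summand \<open>y * ?v m k\<close> is the term \<open>i = k\<close>,
        where \<open>max 1 (k - i)\<close> is 1.\<close>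
      have "y * ?v m k + (case k of 0 \<Rightarrow> 0 | Suc k \<Rightarrow> (\<Sum>i\<le>k. y ^ Suc (k - i) * ?v m i)) =
          max_run y C k (Suc m)" for k
        by (cases k) (auto simp: max_run_def Suc_diff_le max_def intro!: sum.cong)
      then show ?thesis
        using main[OF 1 \<open>Suc n = card S\<close> Suc, of M] Suc by simp
    qed
  next
    case 2
    have "y * ?v m k + (case k of 0 \<Rightarrow> 0 | Suc k \<Rightarrow> (\<Sum>i\<le>k. y ^ Suc (k - i) * ?v m i)) * y =
        (\<Sum>i\<le>k. y ^ Suc (k - i) * ?v m i)" for k
      by (cases k) (auto simp: sum_distrib_left sum_distrib_right Suc_diff_le mult_ac intro!: sum.cong)
    then show ?case
      using main[OF 2(4,5) \<open>Suc n = card S\<close> 2(3) disjI2[OF conjI[OF 2(1,2)]]] 2(1)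
      by (simp add: mult.commute)
  }
qed

section \<open>Recovering the two series and solving for \<open>F_series\<close>\<close>

text \<open>From maximum 0 there are no holes and all values lie above, so \<open>max_run\<close> is
  \<open>y\<close> times an iterate at 0; \<open>y \<noteq> 0\<close> lets this factor
  cancel.\<close>

lemma sum_scan_permutations:
  fixes y :: "'a::idom"
  assumes "y \<noteq> 0" "n \<ge> 1"
  shows "(\<Sum>\<sigma>\<in>{\<sigma> \<in> permutations_of_set {1..n}. scan C 0 \<sigma>}. y ^ asc \<sigma>) =
    fps_nth (iter_series y (end_weight y C)) n"
proof -
  let ?A = "{\<sigma> \<in> permutations_of_set {1..n}. scan C 0 \<sigma>}"
  \<comment> \<open>Prepending \<open>0\<close> as a fictitious first maximum costs exactly one ascent.\<close>
  have asc: "asc (0 # \<sigma>) = Suc (asc \<sigma>)" if "\<sigma> \<in> ?A" for \<sigma>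
  proof -
    have "0 \<notin> set \<sigma>" "\<sigma> \<noteq> []" using that assms(2) by (auto simp: permutations_of_set_def)
    then show ?thesis by (cases \<sigma>) (auto simp: asc_Cons_Cons)
  qed
  have "y * (\<Sum>\<sigma>\<in>?A. y ^ asc \<sigma>) = scan_sum y C 0 0 {1..n}"
    unfolding scan_sum_def sum_distrib_left by (rule sum.cong[OF refl]) (simp only: asc power_Suc)
  also have "\<dots> = max_run y C 0 n"
  proof -
    have "{z\<in>{1..n}. z < 0} = {}" "{z\<in>{1..n}. 0 < z} = {1..n}" by auto
    then show ?thesis by (simp add: scan_sum_eq)
  qed
  also have "\<dots> = y * (fps_nth (iter_series y (end_weight y C)) n)"
    using assms(2) by (cases n) (auto simp: max_run_def iter_series_def)
  finally show ?thesis using assms(1) by simp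
qed

theorem theorem15:
  shows "F_series = E_series * (1 - fps_Y * E_series) / (1 - E_series - fps_Y * E_series)"
proof -
  let ?D = "1 - E_series - fps_Y * E_series"
  let ?y = "fps_X :: rat fps"
  have F: "F_series = iter_series ?y (end_weight ?y False)"
    by (rule fps_ext) (auto simp: F_series_def avoiders_T1 sum_scan_permutations iter_series_def
        simp flip: One_nat_def)
  have E: "E_series = iter_series ?y (end_weight ?y True)"
    by (rule fps_ext) (auto simp: E_series_def avoiders_T1_last sum_scan_permutations iter_series_def
        simp flip: One_nat_def)
  have "F_series = E_series + fps_const (- ?y) * (E_series * E_series)
      + fps_const (1 + ?y) * (F_series * E_series)"
    unfolding F E by (rule iter_series_equation)
  moreover have "fps_const (- ?y) = - fps_Y" "fps_const (1 + ?y) = 1 + fps_Y"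
    by (simp_all add: fps_Y_def flip: fps_const_add fps_const_1_eq_1)
  ultimately have eq: "F_series * ?D = E_series * (1 - fps_Y * E_series)"
    by (simp add: algebra_simps)
  also have "\<dots> = E_series * (1 - fps_Y * E_series) / ?D * ?D"
    by (simp only: fps_divide_mult_cancel[OF fps_nth_0_denominator])
  \<comment> \<open>The denominator has constant coefficient 1, so it is nonzero and can be
    cancelled.\<close>
  finally show ?thesis
    using fps_nth_0_denominator by (metis mult_right_cancel fps_zero_nth zero_neq_one)
qed

end
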